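(* Let $p$ be a prime. Let $x^{(n)}=(x^{(n)}_0,x^{(n)}_1,\ldots)\in S_p$, $n\in\mathbb{N}$, be such that $x^{(n)}\to e$ in the $p$-adic solenoid $S_p$. Let $\{X_{n,k}:n\in\mathbb{N},\ k=1,\ldots,K_n\}$ be an array of random elements in $S_p$ such that for each $n$ the elements $X_{n,1},\ldots,X_{n,K_n}$ are independent and identically distributed, $K_n\to\infty$, and each $X_{n,k}$ takes the value $x^{(n)}$ and its group inverse $-x^{(n)}$ with probability $\frac12$ each, i.e. has distribution $\frac12(\delta_{x^{(n)}}+\delta_{-x^{(n)}})$. Then the array is infinitesimal. If $b$ is a nonnegative real number, then the distribution of $\sum_{k=1}^{K_n}X_{n,k}$ converges weakly to $\gamma_{\psi_b}$ as $n\to\infty$ if and only if $K_n\bigl(\arg(x^{(n)}_0)\bigr)^2\to b$. Moreover, the distribution of $\sum_{k=1}^{K_n}X_{n,k}$ converges weakly to $\omega_{S_p}$ as $n\to\infty$ if and only if $K_n\bigl(\arg(x^{(n)}_0)\bigr)^2\to\infty$.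
   Context: $\mathbb{N}$ and $\mathbb{Z}_+$ are the sets of positive and of nonnegative integers. $\mathbb{T}=\{e^{ix}:-\pi\le x<\pi\}$ is the circle group under multiplication. $S_p=\{(y_0,y_1,\ldots)\in\mathbb{T}^\infty:y_j=y_{j+1}^p\text{ for all }j\in\mathbb{Z}_+\}$, a compact Abelian group under coordinatewise multiplication with the topology inherited from the product topology; its identity is $e=(1,1,\ldots)$. The group operation is denoted additively: $\sum_{k=1}^{K_n}X_{n,k}$ is the coordinatewise product of $X_{n,1},\ldots,X_{n,K_n}$, and $-y=(y_0^{-1},y_1^{-1},\ldots)$ is the group inverse of $y$. $\delta_y$ is the Dirac measure at $y$. $\arg:\mathbb{T}\to[-\pi,\pi)$ is given by $\arg(e^{ix})=x$ for $-\pi\le x<\pi$. Infinitesimal: $\lim_{n\to\infty}\max_{1\le k\le K_n}\mathrm{P}(X_{n,k}\in S_p\setminus U)=0$ for every Borel set $U$ containing an open set that contains $e$. The characters of $S_p$ are $\chi_{d,\ell}(y)=y_d^\ell$, $d\in\mathbb{Z}_+$, $\ell\in\mathbb{Z}$, and $\gamma_{\psi_b}$ is the (existing, unique) probability measure on $S_p$ with $\int_{S_p}y_d^\ell\,d\gamma_{\psi_b}(y)=\exp\{-b\ell^2/(2p^{2d})\}$ for all $d\in\mathbb{Z}_+$, $\ell\in\mathbb{Z}$. $\omega_{S_p}$ is the normalized Haar measure on $S_p$. *)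

theory Defs
  imports "HOL-Probability.Probability"
begin

text \<open>The circle group is the unit sphere of the complex plane. The type class topology of
  \<^typ>\<open>nat \<Rightarrow> complex\<close> is the product topology, so \<open>top_of_set (solenoid p)\<close> is the topology that
  the solenoid inherits from it.\<close>

definition solenoid :: "nat \<Rightarrow> (nat \<Rightarrow> complex) set" where
  "solenoid p = {y. (\<forall>j. y j \<in> sphere 0 1) \<and> (\<forall>j. y j = y (Suc j) ^ p)}"

definition sol_one :: "nat \<Rightarrow> complex" where
  "sol_one = (\<lambda>j. 1)"

definition sol_mult :: "(nat \<Rightarrow> complex) \<Rightarrow> (nat \<Rightarrow> complex) \<Rightarrow> (nat \<Rightarrow> complex)" where
  "sol_mult x y = (\<lambda>j. x j * y j)"

definition sol_inv :: "(nat \<Rightarrow> complex) \<Rightarrow> (nat \<Rightarrow> complex)" where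
  "sol_inv x = (\<lambda>j. inverse (x j))"

text \<open>The group sum (written additively in the mathematics) of a finite family, that is, its
  coordinatewise product.\<close>

definition sol_sum :: "('i \<Rightarrow> nat \<Rightarrow> complex) \<Rightarrow> 'i set \<Rightarrow> (nat \<Rightarrow> complex)" where
  "sol_sum f I = (\<lambda>j. \<Prod>i\<in>I. f i j)"

definition sol_borel :: "nat \<Rightarrow> (nat \<Rightarrow> complex) measure" where
  "sol_borel p = restrict_space borel (solenoid p)"

text \<open>The library's \<^const>\<open>Arg\<close> takes values in \<open>(-\<pi>, \<pi>]\<close>; here the interval is \<open>[-\<pi>, \<pi>)\<close>. Only
  meaningful on the unit circle.\<close>

definition circle_arg :: "complex \<Rightarrow> real" where
  "circle_arg z = (THE x. - pi \<le> x \<and> x < pi \<and> cis x = z)"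

definition infinitesimal_array ::
  "nat \<Rightarrow> 'w measure \<Rightarrow> (nat \<Rightarrow> nat) \<Rightarrow> (nat \<Rightarrow> nat \<Rightarrow> 'w \<Rightarrow> (nat \<Rightarrow> complex)) \<Rightarrow> bool" where
  "infinitesimal_array p M K X \<longleftrightarrow>
    (\<forall>U \<in> sets (sol_borel p).
      (\<exists>V. openin (top_of_set (solenoid p)) V \<and> sol_one \<in> V \<and> V \<subseteq> U) \<longrightarrow>
      (\<lambda>n. Max ((\<lambda>k. measure M {w \<in> space M. X n k w \<in> solenoid p - U}) ` {1..K n}))
        \<longlonglongrightarrow> 0)"

text \<open>Weak convergence of Borel measures on the subspace \<open>S\<close> (the library's \<^const>\<open>weak_conv_m\<close> is
  restricted to the real line).\<close>

definition weak_conv_on ::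
  "'a::topological_space set \<Rightarrow> (nat \<Rightarrow> 'a measure) \<Rightarrow> 'a measure \<Rightarrow> bool" where
  "weak_conv_on S \<mu> \<nu> \<longleftrightarrow>
    (\<forall>f :: 'a \<Rightarrow> real. continuous_on S f \<and> bounded (f ` S) \<longrightarrow>
      (\<lambda>n. \<integral>y. f y \<partial>\<mu> n) \<longlonglongrightarrow> (\<integral>y. f y \<partial>\<nu>))"

text \<open>The Gauss measure and the Haar measure are selected by the properties that determine them
  uniquely among the Borel probability measures on the solenoid (for prime \<open>p\<close> and \<open>b \<ge> 0\<close>): the
  Fourier transform and the invariance under translations, respectively.\<close>

definition gauss_measure :: "nat \<Rightarrow> real \<Rightarrow> (nat \<Rightarrow> complex) measure" where
  "gauss_measure p b = (THE \<mu>. prob_space \<mu> \<and> sets \<mu> = sets (sol_borel p) \<and>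
    (\<forall>(d::nat) (l::int). (\<integral>y. y d powi l \<partial>\<mu>) =
      complex_of_real (exp (- (b * (of_int l)\<^sup>2 / (2 * real p ^ (2 * d))))))) "

definition haar_measure :: "nat \<Rightarrow> (nat \<Rightarrow> complex) measure" where
  "haar_measure p = (THE \<mu>. prob_space \<mu> \<and> sets \<mu> = sets (sol_borel p) \<and>
    (\<forall>x \<in> solenoid p. distr \<mu> (sol_borel p) (sol_mult x) = \<mu>))"

end

theory Submission
  imports Defs "HOL-Real_Asymp.Real_Asymp"
begin

text \<open>On the compact solenoid, real parts of linear combinations of characters form an algebra that
  separates points. By Stone--Weierstrass, convergence of the Fourier coefficients is therefore
  equivalent to weak convergence, and a probability measure is determined by its coefficients.
  The row sum has Fourier coefficient \<open>cos (l \<theta>\<^sub>n / p\<^sup>d) ^ K\<^sub>n\<close> at the character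
  \<open>y \<mapsto> y\<^sub>d\<^sup>l\<close>, where \<open>\<theta>\<^sub>n = arg (x n 0)\<close>, because \<open>x n d = cis (\<theta>\<^sub>n / p\<^sup>d)\<close> for large
  \<open>n\<close>. Since \<open>ln (cos u) \<sim> - u\<^sup>2 / 2\<close> at \<open>0\<close>, the limit of these coefficients is governed by
  \<open>K\<^sub>n \<theta>\<^sub>n\<^sup>2\<close>, and the single character \<open>y\<^sub>0\<close> already recovers that limit. The Gauss measure is
  the image of a normal distribution under the one-parameter subgroup
  \<open>t \<mapsto> (cis (t / p\<^sup>d))\<^sub>d\<close>.\<close>

subsection \<open>The solenoid and its characters\<close>

lemma solenoid_norm: "y \<in> solenoid p \<Longrightarrow> norm (y j) = 1"
  unfolding solenoid_def mem_Collect_eq mem_sphere_0 by blast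

lemma solenoid_step: "y \<in> solenoid p \<Longrightarrow> y (Suc j) ^ p = y j"
  unfolding solenoid_def mem_Collect_eq by (elim conjE allE[of _ j], erule sym)

lemma solenoid_nonzero: "y \<in> solenoid p \<Longrightarrow> y j \<noteq> 0"
  using solenoid_norm[of y p j] by auto

lemma solenoid_power: "y \<in> solenoid p \<Longrightarrow> y (d + m) ^ (p ^ m) = y d"
proof (induction m)
  case (Suc m)
  have "y (d + Suc m) ^ (p ^ Suc m) = (y (Suc (d + m)) ^ p) ^ (p ^ m)"
    by (simp add: power_mult)
  also have "y (Suc (d + m)) ^ p = y (d + m)"
    using Suc.prems by (rule solenoid_step)
  finally show ?case using Suc by simp
qed simp

text \<open>Since \<open>y d\<close> is the \<open>p ^ m\<close>-th power of
  \<open>y (d + m)\<close>, every character is also a character of any deeper coordinate. Two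
  characters can thus be brought to a common coordinate and multiplied there.\<close>

lemma character_refine:
  assumes "y \<in> solenoid p"
  shows "y d powi l = y (d + m) powi (int (p ^ m) * l)"
proof -
  have "y (d + m) powi (int (p ^ m) * l) = (y (d + m) ^ (p ^ m)) powi l"
    by (simp only: power_int_mult power_int_of_nat)
  then show ?thesis using solenoid_power[OF assms] by simp
qed

text \<open>By Tychonoff the product of circles is compact, and each relation
  \<open>y j = y (Suc j) ^ p\<close> cuts out a closed set.\<close>

lemma compact_solenoid: "compact (solenoid p)"
proof -
  have "compact (PiE UNIV (\<lambda>_. sphere 0 1) :: (nat \<Rightarrow> complex) set)"
    using compactin_PiE[of "\<lambda>_. euclidean" UNIV "\<lambda>_. sphere (0::complex) 1"]
    by (simp add: euclidean_product_topology)
  moreover have "closed {y :: nat \<Rightarrow> complex. y j = y (Suc j) ^ p}" for j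
    by (intro closed_Collect_eq continuous_intros continuous_on_product_coordinates)
  then have "closed (\<Inter>j. {y :: nat \<Rightarrow> complex. y j = y (Suc j) ^ p})"
    by (rule closed_INT[OF ballI])
  moreover have "solenoid p = PiE UNIV (\<lambda>_. sphere 0 1) \<inter> (\<Inter>j. {y. y j = y (Suc j) ^ p})"
    unfolding solenoid_def PiE_UNIV_domain Pi_def by blast
  ultimately show ?thesis
    by (simp add: compact_Int_closed)
qed

lemma space_sol_borel [simp]: "space (sol_borel p) = solenoid p"
  by (simp add: sol_borel_def space_restrict_space)

lemma continuous_on_coordinate: "continuous_on S (\<lambda>y :: nat \<Rightarrow> 'a :: topological_space. y d)"
  by (rule continuous_on_subset[OF continuous_on_product_coordinates]) auto

lemma continuous_on_character: "continuous_on (solenoid p) (\<lambda>y. y d powi l)"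
  by (intro continuous_on_power_int continuous_on_coordinate) (auto dest: solenoid_nonzero)

lemma measurable_sol_borelI:
  assumes "f \<in> borel_measurable M" "\<And>w. w \<in> space M \<Longrightarrow> f w \<in> solenoid p"
  shows "f \<in> measurable M (sol_borel p)"
  unfolding sol_borel_def by (rule measurable_restrict_space2) (use assms in auto)

lemma measurable_sol_borel_continuous:
  "continuous_on (solenoid p) f \<Longrightarrow> f \<in> borel_measurable (sol_borel p)"
  unfolding sol_borel_def by (rule borel_measurable_continuous_on_restrict)

lemma integrable_continuous_solenoid:
  fixes f :: "(nat \<Rightarrow> complex) \<Rightarrow> 'b :: {banach, second_countable_topology}"
  assumes "finite_measure \<mu>" and sets: "sets \<mu> = sets (sol_borel p)"
    and f: "continuous_on (solenoid p) f"
  shows "integrable \<mu> f"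
proof -
  interpret finite_measure \<mu> by fact
  have "bounded (f ` solenoid p)"
    by (intro compact_imp_bounded compact_continuous_image f compact_solenoid)
  then obtain B where "\<And>y. y \<in> solenoid p \<Longrightarrow> norm (f y) \<le> B"
    by (auto simp: bounded_iff)
  moreover have "space \<mu> = solenoid p"
    using sets_eq_imp_space_eq[OF sets] by simp
  moreover have "f \<in> borel_measurable \<mu>"
    using measurable_sol_borel_continuous[OF f] measurable_cong_sets[OF sets refl] by blast
  ultimately show ?thesis
    by (intro integrable_const_bound[of _ B]) auto
qed

section \<open>Real trigonometric polynomials on the solenoid\<close>

text \<open>Finite sums of real parts of multiples of characters, the real algebra to which
  Stone--Weierstrass is applied. Both clauses compare functions only on the solenoid, so identities
  that hold only there, such as conjugate equals inverse, can be used for rewriting.\<close>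

inductive trig_poly :: "nat \<Rightarrow> ((nat \<Rightarrow> complex) \<Rightarrow> real) \<Rightarrow> bool" for p where
  char: "(\<And>y. y \<in> solenoid p \<Longrightarrow> f y = Re (c * y d powi l)) \<Longrightarrow> trig_poly p f"
| add: "trig_poly p g \<Longrightarrow> trig_poly p h \<Longrightarrow>
    (\<And>y. y \<in> solenoid p \<Longrightarrow> f y = g y + h y) \<Longrightarrow> trig_poly p f"

lemma trig_poly_continuous: "trig_poly p f \<Longrightarrow> continuous_on (solenoid p) f"
proof (induction rule: trig_poly.induct)
  case (char f c d l)
  have "continuous_on (solenoid p) (\<lambda>y. Re (c * y d powi l))"
    by (intro continuous_intros continuous_on_character)
  then show ?case using char by (simp cong: continuous_on_cong)
next
  case (add g h f)
  then have "continuous_on (solenoid p) (\<lambda>y. g y + h y)"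
    by (intro continuous_intros)
  then show ?case using add.hyps by (simp cong: continuous_on_cong)
qed

text \<open>After both characters are moved to coordinate \<open>d + e\<close>, the identity Re u Re
  v = Re (u v / 2) + Re (u cnj v / 2) applies. On the circle conjugation is inversion, so the two
  terms carry the sum and the difference of the exponents.\<close>

lemma trig_poly_mult_char:
  assumes "trig_poly p f"
  shows "trig_poly p (\<lambda>y. f y * Re (b * y e powi k))"
  using assms
proof (induction rule: trig_poly.induct)
  case (char f c d l)
  have Re: "Re u * Re v = Re (u * v / 2) + Re (u * cnj v / 2)" for u v
    by (simp add: field_simps)
  have eq: "f y * Re (b * y e powi k) =
      Re (c * b / 2 * y (d + e) powi (int (p ^ e) * l + int (p ^ d) * k)) +
      Re (c * cnj b / 2 * y (d + e) powi (int (p ^ e) * l - int (p ^ d) * k))"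
    if y: "y \<in> solenoid p" for y
  proof -
    have nz: "y (d + e) \<noteq> 0" by (rule solenoid_nonzero[OF y])
    have "cnj (y (d + e)) = inverse (y (d + e))"
      using solenoid_norm[OF y, of "d + e"] by (simp add: inverse_complex_def complex_eq_iff cmod_def)
    then have cnj: "cnj (y (d + e) powi j) = y (d + e) powi (- j)" for j
      by (simp add: power_int_minus power_int_inverse)
    have "f y * Re (b * y e powi k) = Re (c * y (d + e) powi (int (p ^ e) * l)) *
        Re (b * y (d + e) powi (int (p ^ d) * k))"
      using char[OF y] character_refine[OF y, of d l e] character_refine[OF y, of e k d]
      by (simp add: add.commute)
    also have "\<dots> = Re (c * y (d + e) powi (int (p ^ e) * l) * (b * y (d + e) powi (int (p ^ d) * k)) / 2)
        + Re (c * y (d + e) powi (int (p ^ e) * l) * (cnj b * y (d + e) powi (- (int (p ^ d) * k))) / 2)"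
      by (subst Re) (simp only: complex_cnj_mult cnj)
    finally show ?thesis
      using nz by (simp only: power_int_add diff_conv_add_uminus mult_ac times_divide_eq_left
          times_divide_eq_right simp_thms)
  qed
  show ?case
    by (rule trig_poly.add[OF trig_poly.char trig_poly.char eq]) (rule refl)+
next
  case (add g h f)
  show ?case
    by (rule trig_poly.add[OF add.IH]) (simp add: add.hyps algebra_simps)
qed

lemma trig_poly_mult:
  assumes "trig_poly p g" "trig_poly p f"
  shows "trig_poly p (\<lambda>y. f y * g y)"
  using assms(1)
proof (induction rule: trig_poly.induct)
  case (char g c d l)
  \<comment> \<open>The second summand is the zero function; the sum clause serves here only to
    replace a function by one equal to it on the solenoid.\<close>
  show ?case
    by (rule trig_poly.add[OF trig_poly_mult_char[OF assms(2), of c d l]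
      trig_poly.char[of _ "\<lambda>y. 0" 0]]) (auto simp: char)
next
  case (add g h k)
  show ?case
    by (rule trig_poly.add[OF add.IH]) (simp add: add.hyps algebra_simps)
qed

lemma function_ring_trig_poly: "function_ring_on (Collect (trig_poly p)) (solenoid p)"
proof
  show "compact (solenoid p)" by (rule compact_solenoid)
next
  fix x y assume xy: "x \<in> solenoid p" "y \<in> solenoid p" "x \<noteq> y"
  then obtain d where "x d \<noteq> y d" by blast
  then consider "Re (x d) \<noteq> Re (y d)" | "Im (x d) \<noteq> Im (y d)" by (auto simp: complex_eq_iff)
  then show "\<exists>f\<in>Collect (trig_poly p). f x \<noteq> f y"
  proof cases
    case 1
    then show ?thesis
      by (intro bexI[of _ "\<lambda>y. Re (1 * y d powi 1)"] CollectI trig_poly.char[of _ _ 1 d 1]) auto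
  next
    case 2
    then show ?thesis
      by (intro bexI[of _ "\<lambda>y. Re (- \<i> * y d powi 1)"] CollectI trig_poly.char[of _ _ "- \<i>" d 1]) auto
  qed
next
  fix c :: real
  show "(\<lambda>_. c) \<in> Collect (trig_poly p)"
    by (intro CollectI trig_poly.char[of _ _ "of_real c" 0 0]) simp
next
  fix f g assume "f \<in> Collect (trig_poly p)" "g \<in> Collect (trig_poly p)"
  then show "(\<lambda>y. f y + g y) \<in> Collect (trig_poly p)"
    using trig_poly.add[of p f g] by simp
qed (auto intro: trig_poly_continuous trig_poly_mult)

subsection \<open>Weak convergence and Fourier coefficients\<close>

text \<open>Convergence passes from characters to trigonometric polynomials by linearity, and from
  these to all continuous functions by uniform approximation, since probability measures do not
  enlarge a uniform error.\<close>

lemma weak_conv_on_solenoidI: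
  assumes \<mu>: "\<forall>\<^sub>F n in sequentially. prob_space (\<mu> n) \<and> sets (\<mu> n) = sets (sol_borel p)"
    and \<nu>: "prob_space \<nu>" "sets \<nu> = sets (sol_borel p)"
    and conv: "\<And>d l. (\<lambda>n. \<integral>y. y d powi l \<partial>\<mu> n) \<longlonglongrightarrow> (\<integral>y. y d powi l \<partial>\<nu>)"
  shows "weak_conv_on (solenoid p) \<mu> \<nu>"
proof -
  have int: "integrable m f" if "prob_space m" "sets m = sets (sol_borel p)" "continuous_on (solenoid p) f"
    for m and f :: "(nat \<Rightarrow> complex) \<Rightarrow> 'b :: {banach, second_countable_topology}"
    using that prob_space.axioms(1) integrable_continuous_solenoid by blast
  have space: "space m = solenoid p" if "sets m = sets (sol_borel p)" for m
    using sets_eq_imp_space_eq[OF that] by simp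
  have trig: "(\<lambda>n. \<integral>y. f y \<partial>\<mu> n) \<longlonglongrightarrow> (\<integral>y. f y \<partial>\<nu>)" if "trig_poly p f" for f
    using that
  proof (induction rule: trig_poly.induct)
    case (char f c d l)
    have eq: "(\<integral>y. f y \<partial>m) = Re (c * (\<integral>y. y d powi l \<partial>m))"
      if m: "prob_space m" "sets m = sets (sol_borel p)" for m
    proof -
      have i: "integrable m (\<lambda>y. y d powi l)"
        by (rule int[OF m continuous_on_character])
      have "(\<integral>y. f y \<partial>m) = (\<integral>y. Re (c * y d powi l) \<partial>m)"
        by (rule Bochner_Integration.integral_cong) (auto simp: char space[OF m(2)])
      also have "\<dots> = Re (\<integral>y. c * y d powi l \<partial>m)"
        by (rule integral_Re) (use i in auto)
      finally show ?thesis by simp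
    qed
    have "(\<lambda>n. Re (c * (\<integral>y. y d powi l \<partial>\<mu> n))) \<longlonglongrightarrow> Re (c * (\<integral>y. y d powi l \<partial>\<nu>))"
      by (intro tendsto_intros conv)
    then show ?case
      unfolding eq[OF \<nu>]
      by (rule Lim_transform_eventually) (use \<mu> in \<open>eventually_elim, simp add: eq\<close>)
  next
    case (add g h f)
    have eq: "(\<integral>y. f y \<partial>m) = (\<integral>y. g y \<partial>m) + (\<integral>y. h y \<partial>m)"
      if m: "prob_space m" "sets m = sets (sol_borel p)" for m
    proof -
      have "(\<integral>y. f y \<partial>m) = (\<integral>y. g y + h y \<partial>m)"
        by (rule Bochner_Integration.integral_cong) (auto simp: add.hyps space[OF m(2)])
      then show ?thesis
        using int[OF m trig_poly_continuous] add.hyps by simp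
    qed
    have "(\<lambda>n. (\<integral>y. g y \<partial>\<mu> n) + (\<integral>y. h y \<partial>\<mu> n)) \<longlonglongrightarrow> (\<integral>y. g y \<partial>\<nu>) + (\<integral>y. h y \<partial>\<nu>)"
      by (intro tendsto_intros add.IH)
    then show ?case
      unfolding eq[OF \<nu>]
      by (rule Lim_transform_eventually) (use \<mu> in \<open>eventually_elim, simp add: eq\<close>)
  qed
  show ?thesis
    unfolding weak_conv_on_def
  proof (intro allI impI, elim conjE)
    fix f :: "(nat \<Rightarrow> complex) \<Rightarrow> real"
    assume f: "continuous_on (solenoid p) f"
    show "(\<lambda>n. \<integral>y. f y \<partial>\<mu> n) \<longlonglongrightarrow> (\<integral>y. f y \<partial>\<nu>)"
    proof (rule LIMSEQ_I)
      fix e :: real assume "0 < e"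
      interpret function_ring_on "Collect (trig_poly p)" "solenoid p"
        by (rule function_ring_trig_poly)
      \<comment> \<open>One third of \<open>e\<close> is spent on replacing \<open>f\<close> by
        \<open>g\<close> under \<open>\<mu> n\<close>, one on the convergence for \<open>g\<close>,
        and one on replacing \<open>g\<close> by \<open>f\<close> under
        \<open>\<nu>\<close>.\<close>
      obtain g where g: "trig_poly p g" "\<And>y. y \<in> solenoid p \<Longrightarrow> \<bar>f y - g y\<bar> < e / 3"
        using Stone_Weierstrass_basic[OF f, of "e / 3"] \<open>0 < e\<close> by auto
      have close: "\<bar>(\<integral>y. f y \<partial>m) - (\<integral>y. g y \<partial>m)\<bar> \<le> e / 3"
        if m: "prob_space m" "sets m = sets (sol_borel p)" for m
      proof -
        interpret m: prob_space m by fact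
        have i: "integrable m f" "integrable m g"
          using int[OF m f] int[OF m trig_poly_continuous[OF g(1)]] by auto
        have "\<bar>(\<integral>y. f y \<partial>m) - (\<integral>y. g y \<partial>m)\<bar> = \<bar>\<integral>y. f y - g y \<partial>m\<bar>"
          using i by simp
        also have "\<dots> \<le> (\<integral>y. \<bar>f y - g y\<bar> \<partial>m)"
          using i by (intro integral_abs_bound)
        also have "\<dots> \<le> (\<integral>y. e / 3 \<partial>m)"
          using i g(2) by (intro integral_mono) (auto simp: space[OF m(2)] less_imp_le)
        finally show ?thesis by (simp add: m.prob_space)
      qed
      have "\<forall>\<^sub>F n in sequentially. norm ((\<integral>y. g y \<partial>\<mu> n) - (\<integral>y. g y \<partial>\<nu>)) < e / 3"
        using tendstoD[OF trig[OF g(1)], of "e / 3"] \<open>0 < e\<close> by (simp add: dist_norm)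
      with \<mu> have "\<forall>\<^sub>F n in sequentially. norm ((\<integral>y. f y \<partial>\<mu> n) - (\<integral>y. f y \<partial>\<nu>)) < e"
      proof eventually_elim
        case (elim n)
        have "norm ((\<integral>y. g y \<partial>\<mu> n) - (\<integral>y. g y \<partial>\<nu>)) < e / 3" by fact
        moreover have "\<bar>(\<integral>y. f y \<partial>\<mu> n) - (\<integral>y. g y \<partial>\<mu> n)\<bar> \<le> e / 3"
          using elim by (intro close) auto
        moreover note close[OF \<nu>]
        ultimately show ?case by (simp add: abs_real_def split: if_splits)
      qed
      then show "\<exists>no. \<forall>n\<ge>no. norm ((\<integral>y. f y \<partial>\<mu> n) - (\<integral>y. f y \<partial>\<nu>)) < e"
        by (simp add: eventually_sequentially)
    qed
  qed
qed

text \<open>Weak convergence is tested on real functions, hence the real parts. The coefficients to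
  which this is applied are real.\<close>

lemma weak_conv_on_solenoidD:
  assumes conv: "weak_conv_on (solenoid p) \<mu> \<nu>"
    and \<mu>: "\<forall>\<^sub>F n in sequentially. prob_space (\<mu> n) \<and> sets (\<mu> n) = sets (sol_borel p)"
    and \<nu>: "prob_space \<nu>" "sets \<nu> = sets (sol_borel p)"
  shows "(\<lambda>n. Re (\<integral>y. y d powi l \<partial>\<mu> n)) \<longlonglongrightarrow> Re (\<integral>y. y d powi l \<partial>\<nu>)"
proof -
  let ?f = "\<lambda>y :: nat \<Rightarrow> complex. Re (y d powi l)"
  have eq: "(\<integral>y. ?f y \<partial>m) = Re (\<integral>y. y d powi l \<partial>m)"
    if "prob_space m" "sets m = sets (sol_borel p)" for m
    using that by (intro integral_Re integrable_continuous_solenoid continuous_on_character)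
      (auto intro: prob_space.axioms(1))
  have f: "continuous_on (solenoid p) ?f"
    by (intro continuous_intros continuous_on_character)
  moreover have "bounded (?f ` solenoid p)"
    by (intro compact_imp_bounded compact_continuous_image f compact_solenoid)
  ultimately have "(\<lambda>n. \<integral>y. ?f y \<partial>\<mu> n) \<longlonglongrightarrow> (\<integral>y. ?f y \<partial>\<nu>)"
    using conv by (simp add: weak_conv_on_def)
  then show ?thesis
    unfolding eq[OF \<nu>]
    by (rule Lim_transform_eventually) (use \<mu> in \<open>eventually_elim, simp add: eq\<close>)
qed

section \<open>Measures determined by their Fourier coefficients\<close>

text \<open>The indicator of a closed set is the pointwise limit of the bounded continuous functions
  \<open>max 0 (1 - real n * infdist y C)\<close>. By dominated convergence the measures agree on
  closed sets, an intersection-stable generator of the Borel sets.\<close>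

lemma finite_borel_measure_eqI_continuous:
  fixes \<mu> \<nu> :: "'a :: metric_space measure"
  assumes fin: "finite_measure \<mu>" "finite_measure \<nu>"
    and sets: "sets \<mu> = sets borel" "sets \<nu> = sets borel"
    and eq: "\<And>f :: 'a \<Rightarrow> real. continuous_on UNIV f \<Longrightarrow> bounded (range f) \<Longrightarrow>
      (\<integral>y. f y \<partial>\<mu>) = (\<integral>y. f y \<partial>\<nu>)"
  shows "\<mu> = \<nu>"
proof -
  have closed: "emeasure \<mu> C = emeasure \<nu> C" if C: "closed C" for C
  \<comment> \<open>The distance \<open>infdist\<close> to the empty set is 0 by convention, so the
    approximating functions would be constantly 1 there; hence the separate case.\<close>
  proof (cases "C = {}")
    case False
    define f where "f n y = max 0 (1 - real n * infdist y C)" for n y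
    have cont: "continuous_on UNIV (f n)" for n
      unfolding f_def by (intro continuous_intros)
    have f01: "0 \<le> f n y" "f n y \<le> 1" for n y
      by (auto simp: f_def infdist_nonneg)
    have lim: "(\<lambda>n. f n y) \<longlonglongrightarrow> indicator C y" for y
    proof (cases "y \<in> C")
      case True
      then show ?thesis by (simp add: f_def)
    next
      case nC: False
      have pos: "infdist y C > 0"
        by (rule infdist_pos_not_in_closed) (use C False nC in auto)
      obtain N where N: "real N > 1 / infdist y C" using reals_Archimedean2 by blast
      have "f n y = 0" if "n \<ge> N" for n
      proof -
        have "1 \<le> real N * infdist y C" using N pos by (simp add: field_simps)
        also have "\<dots> \<le> real n * infdist y C" using that pos by (intro mult_right_mono) auto
        finally show ?thesis by (simp add: f_def)
      qed
      then have "\<forall>\<^sub>F n in sequentially. f n y = indicator C y"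
        using nC by (auto simp: eventually_sequentially)
      then show ?thesis by (rule tendsto_eventually)
    qed
    have conv: "(\<lambda>n. \<integral>y. f n y \<partial>m) \<longlonglongrightarrow> measure m C"
      if m: "finite_measure m" "sets m = sets borel" for m
    proof -
      interpret m: finite_measure m by fact
      have "C \<in> sets m" using C m by auto
      then have "measure m C = (\<integral>y. indicator C y \<partial>m)"
        by simp
      moreover have "(\<lambda>n. \<integral>y. f n y \<partial>m) \<longlonglongrightarrow> (\<integral>y. indicator C y \<partial>m)"
      proof (rule integral_dominated_convergence[where w = "\<lambda>_. 1"])
        show "f n \<in> borel_measurable m" for n
          using borel_measurable_continuous_onI[OF cont] measurable_cong_sets[OF m(2) refl] by blast
        show "indicator C \<in> borel_measurable m" using \<open>C \<in> sets m\<close> by simp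
      qed (use lim f01 in auto)
      ultimately show ?thesis by simp
    qed
    have "(\<integral>y. f n y \<partial>\<mu>) = (\<integral>y. f n y \<partial>\<nu>)" for n
      by (rule eq[OF cont]) (use f01 in \<open>auto simp: bounded_iff intro!: exI[of _ 1]\<close>)
    then have "measure \<mu> C = measure \<nu> C"
      using conv[OF fin(1) sets(1)] conv[OF fin(2) sets(2)] LIMSEQ_unique by force
    then show ?thesis
      using fin by (simp add: finite_measure.emeasure_eq_measure)
  qed simp
  show ?thesis
  proof (rule measure_eqI_generator_eq)
    show "Int_stable (Collect closed :: 'a set set)" by (auto simp: Int_stable_def)
    show "range (\<lambda>_. UNIV) \<subseteq> (Collect closed :: 'a set set)" by auto
    show "emeasure \<mu> UNIV \<noteq> \<infinity>"
      using fin(1) by (simp add: finite_measure.emeasure_eq_measure)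
  qed (use closed sets in \<open>auto simp: borel_eq_closed\<close>)
qed

text \<open>For a constant sequence, convergence of coefficients is equality, so the criterion for
  weak convergence makes all integrals of continuous functions agree. The measures are then pushed
  forward to the whole metric space, and every measurable set of the solenoid is the trace of a
  Borel set there.\<close>

lemma solenoid_measure_eqI:
  assumes \<mu>: "prob_space \<mu>" "sets \<mu> = sets (sol_borel p)"
    and \<nu>: "prob_space \<nu>" "sets \<nu> = sets (sol_borel p)"
    and eq: "\<And>d l. (\<integral>y. y d powi l \<partial>\<mu>) = (\<integral>y. y d powi l \<partial>\<nu>)"
  shows "\<mu> = \<nu>"
proof -
  have "weak_conv_on (solenoid p) (\<lambda>_. \<mu>) \<nu>"
    by (rule weak_conv_on_solenoidI) (use \<mu> \<nu> eq in auto)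
  then have cont: "(\<integral>y. f y \<partial>\<mu>) = (\<integral>y. f y \<partial>\<nu>)"
    if "continuous_on (solenoid p) f" "bounded (f ` solenoid p)" for f :: "_ \<Rightarrow> real"
    using that by (auto simp: weak_conv_on_def LIMSEQ_const_iff)
  have id: "(\<lambda>y. y) \<in> borel_measurable m" if "sets m = sets (sol_borel p)" for m
    using measurable_cong_sets[OF that refl] measurable_sol_borel_continuous[of p "\<lambda>y. y"]
      continuous_on_id by blast
  have space: "space m = solenoid p" if "sets m = sets (sol_borel p)" for m
    using sets_eq_imp_space_eq[OF that] by simp
  have distr: "distr \<mu> borel (\<lambda>y. y) = distr \<nu> borel (\<lambda>y. y)"
  proof (rule finite_borel_measure_eqI_continuous)
    show "finite_measure (distr \<mu> borel (\<lambda>y. y))" "finite_measure (distr \<nu> borel (\<lambda>y. y))"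
      using \<mu> \<nu> id by (auto intro!: prob_space.axioms(1) prob_space.prob_space_distr)
  next
    fix f :: "(nat \<Rightarrow> complex) \<Rightarrow> real"
    assume f: "continuous_on UNIV f" "bounded (range f)"
    then have "f \<in> borel_measurable borel" by (intro borel_measurable_continuous_onI)
    moreover have "(\<integral>y. f y \<partial>\<mu>) = (\<integral>y. f y \<partial>\<nu>)"
      by (rule cont) (use f in \<open>auto intro: continuous_on_subset bounded_subset\<close>)
    ultimately show "(\<integral>y. f y \<partial>distr \<mu> borel (\<lambda>y. y)) = (\<integral>y. f y \<partial>distr \<nu> borel (\<lambda>y. y))"
      using id \<mu> \<nu> by (simp add: integral_distr)
  qed simp_all
  show ?thesis
  proof (rule measure_eqI)
    fix A assume "A \<in> sets \<mu>"
    then obtain B where B: "B \<in> sets borel" "A = B \<inter> solenoid p"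
      using \<mu>(2) by (auto simp: sol_borel_def sets_restrict_space)
    have "emeasure m A = emeasure (distr m borel (\<lambda>y. y)) B" if m: "sets m = sets (sol_borel p)" for m
      using B id[OF m] by (simp add: emeasure_distr space[OF m])
    then show "emeasure \<mu> A = emeasure \<nu> A" using distr \<mu> \<nu> by metis
  qed (use \<mu> \<nu> in simp)
qed

lemma solenoid_coordinate_measurable [measurable]: "(\<lambda>y. y d) \<in> borel_measurable (sol_borel p)"
  by (intro measurable_sol_borel_continuous continuous_on_coordinate)

lemma measurable_character [measurable]: "(\<lambda>y. y d powi l) \<in> borel_measurable (sol_borel p)"
  by (intro measurable_sol_borel_continuous continuous_on_character)

lemma borel_measurable_cis [measurable]: "cis \<in> borel_measurable borel"
  unfolding cis_conv_exp by measurable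

text \<open>This is the one-parameter subgroup: dividing the angle by \<open>p\<close> at each
  coordinate chooses the \<open>p\<close>-th roots consistently.\<close>

lemma cis_curve_in_solenoid:
  assumes "p > 0"
  shows "(\<lambda>d. cis (t / real p ^ d)) \<in> solenoid p"
  unfolding solenoid_def using assms by (auto simp: Complex.DeMoivre)

subsection \<open>The Gauss and Haar measures\<close>

text \<open>The witness for existence is the law of the one-parameter subgroup at a centred normal
  time of variance \<open>b\<close>; its coefficients are values of the normal characteristic
  function. Together with uniqueness this makes the definite description meaningful.\<close>

lemma gauss_measure:
  assumes p: "p > 0" and b: "b \<ge> 0"
  shows "prob_space (gauss_measure p b)"
    and "sets (gauss_measure p b) = sets (sol_borel p)"
    and "(\<integral>y. y d powi l \<partial>gauss_measure p b) =
      complex_of_real (exp (- (b * (of_int l)\<^sup>2 / (2 * real p ^ (2 * d)))))"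
proof -
  define P where "P \<mu> \<longleftrightarrow> prob_space \<mu> \<and> sets \<mu> = sets (sol_borel p) \<and>
    (\<forall>(d::nat) (l::int). (\<integral>y. y d powi l \<partial>\<mu>) =
      complex_of_real (exp (- (b * (of_int l)\<^sup>2 / (2 * real p ^ (2 * d))))))" for \<mu>
  define Y where "Y t d = cis (sqrt b * t / real p ^ d)" for t d
  let ?N = "std_normal_distribution"
  interpret N: real_distribution ?N by (rule real_dist_normal_dist)
  have Y: "Y \<in> measurable ?N (sol_borel p)"
  proof (rule measurable_sol_borelI)
    show "Y \<in> borel_measurable ?N"
      unfolding Y_def by (intro measurable_coordinatewise_then_product) measurable
    show "Y t \<in> solenoid p" for t
      unfolding Y_def by (rule cis_curve_in_solenoid[OF p])
  qed
  have coef: "(\<integral>y. y d powi l \<partial>distr ?N (sol_borel p) Y) =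
      complex_of_real (exp (- (b * (of_int l)\<^sup>2 / (2 * real p ^ (2 * d)))))" for d l
  proof -
    have Y_powi: "Y t d powi l = iexp (of_int l * sqrt b / real p ^ d * t)" for t
      by (simp only: Y_def cis_power_int cis_conv_exp[symmetric]) (simp add: mult_ac)
    have "(\<integral>y. y d powi l \<partial>distr ?N (sol_borel p) Y) = (\<integral>t. Y t d powi l \<partial>?N)"
      by (rule integral_distr[OF Y measurable_character])
    also have "\<dots> = char ?N (of_int l * sqrt b / real p ^ d)"
      by (simp only: char_def Y_powi)
    also have "\<dots> = complex_of_real (exp (- (b * (of_int l)\<^sup>2 / (2 * real p ^ (2 * d)))))"
      using b by (simp add: char_std_normal_distribution power_mult_distrib power_divide
          mult_ac flip: power_mult)
    finally show ?thesis .
  qed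
  have "P (distr ?N (sol_borel p) Y)"
    unfolding P_def using N.prob_space_distr[OF Y] coef by simp
  moreover have "\<mu> = \<nu>" if "P \<mu>" "P \<nu>" for \<mu> \<nu>
    by (rule solenoid_measure_eqI[of _ p]) (use that in \<open>auto simp: P_def\<close>)
  ultimately have "P (THE \<mu>. P \<mu>)"
    by (intro theI[of P])
  then have "P (gauss_measure p b)"
    by (simp add: gauss_measure_def P_def)
  then show "prob_space (gauss_measure p b)" "sets (gauss_measure p b) = sets (sol_borel p)"
    "(\<integral>y. y d powi l \<partial>gauss_measure p b) =
      complex_of_real (exp (- (b * (of_int l)\<^sup>2 / (2 * real p ^ (2 * d)))))"
    unfolding P_def by blast+
qed

section \<open>Integrals behind the construction of the Haar measure\<close>

text \<open>The integrand depends only on the coordinates in \<open>J\<close>, and the marginal of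
  the infinite product on \<open>J\<close> is the finite product, where Fubini applies.\<close>

lemma (in product_prob_space) integral_PiM_prod:
  fixes f :: "'i \<Rightarrow> 'a \<Rightarrow> 'b :: {real_normed_field, banach, second_countable_topology}"
  assumes J: "finite J" "J \<subseteq> I" and f: "\<And>i. i \<in> J \<Longrightarrow> integrable (M i) (f i)"
  shows "(\<integral>\<omega>. (\<Prod>i\<in>J. f i (\<omega> i)) \<partial>PiM I M) = (\<Prod>i\<in>J. \<integral>x. f i x \<partial>M i)"
proof -
  have [measurable]: "(\<lambda>\<omega>. restrict \<omega> J) \<in> measurable (PiM I M) (PiM J M)"
    by (rule measurable_restrict_subset[OF J(2)])
  have m: "(\<lambda>\<omega>. \<Prod>i\<in>J. f i (\<omega> i)) \<in> borel_measurable (PiM J M)"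
    by (rule borel_measurable_prod)
      (use f in \<open>auto intro: measurable_compose[OF measurable_component_singleton]\<close>)
  have "(\<Prod>i\<in>J. \<integral>x. f i x \<partial>M i) = (\<integral>\<omega>. (\<Prod>i\<in>J. f i (\<omega> i)) \<partial>PiM J M)"
    using J f by (simp add: product_integral_prod)
  also have "\<dots> = (\<integral>\<omega>. (\<Prod>i\<in>J. f i (\<omega> i)) \<partial>distr (PiM I M) (PiM J M) (\<lambda>\<omega>. restrict \<omega> J))"
    by (simp add: distr_PiM_restrict_finite[OF J])
  also have "\<dots> = (\<integral>\<omega>. (\<Prod>i\<in>J. f i (restrict \<omega> J i)) \<partial>PiM I M)"
    by (rule integral_distr[OF _ m]) measurable
  also have "\<dots> = (\<integral>\<omega>. (\<Prod>i\<in>J. f i (\<omega> i)) \<partial>PiM I M)"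
    by (intro Bochner_Integration.integral_cong prod.cong) auto
  finally show ?thesis by simp
qed

text \<open>For a nonzero integer frequency the antiderivative \<open>F\<close> has period 1, so its
  increment over the unit interval is 0.\<close>

lemma integral_cis_period:
  fixes m :: int
  assumes "m \<noteq> 0"
  shows "(\<integral>u. cis (2 * pi * m * u) \<partial>density lborel (\<lambda>u. ennreal (indicator {0..1} u))) = 0"
proof -
  let ?c = "complex_of_real (2 * pi * m)"
  have c: "?c \<noteq> 0" using assms by simp
  define F where "F u = cis (2 * pi * m * u) / (\<i> * ?c)" for u :: real
  have F: "(F has_vector_derivative cis (2 * pi * m * u)) (at u within {0..1})" for u
    unfolding F_def cis_conv_exp using assms
    by (auto intro!: derivative_eq_intros has_vector_derivative_real_field simp: field_simps)
  have "(\<integral>u. cis (2 * pi * m * u) \<partial>density lborel (\<lambda>u. ennreal (indicator {0..1} u))) =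
      (\<integral>u. indicator {0..1} u *\<^sub>R cis (2 * pi * m * u) \<partial>lborel)"
    by (subst integral_density) (auto simp: indicator_def)
  also have "\<dots> = F 1 - F 0"
    using F by (intro integral_FTC_Icc) (auto simp: cis_conv_exp intro!: continuous_intros)
  also have "\<dots> = 0"
    by (simp add: F_def)
  finally show ?thesis .
qed

text \<open>Here \<open>cis a\<close> is a \<open>p\<close>-th root of unity other than 1, and its
  powers with exponents below \<open>p\<close> form a geometric sum equal to 0.\<close>

lemma integral_cis_digits:
  assumes p: "p > 0" and "cis (real p * a) = 1" "cis a \<noteq> 1"
  shows "(\<integral>x. cis (a * of_int \<lfloor>x\<rfloor>) \<partial>distr (measure_pmf (pmf_of_set {..<p})) borel real) = 0"
proof -
  have "(\<integral>x. cis (a * of_int \<lfloor>x\<rfloor>) \<partial>distr (measure_pmf (pmf_of_set {..<p})) borel real) =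
      (\<integral>k. cis (a * real k) \<partial>measure_pmf (pmf_of_set {..<p}))"
    by (subst integral_distr) auto
  also have "\<dots> = (\<Sum>k<p. (1 / real p) *\<^sub>R cis (a * real k))"
    using p by (subst integral_measure_pmf[of "{..<p}"])
      (auto simp: set_pmf_of_set[of "{..<p}"] pmf_of_set[of "{..<p}"] lessThan_empty_iff)
  also have "\<dots> = (1 / real p) *\<^sub>R (\<Sum>k<p. cis a ^ k)"
    by (simp add: Complex.DeMoivre mult.commute scaleR_sum_right)
  also have "(\<Sum>k<p. cis a ^ k) = 0"
    using geometric_sum[OF assms(3), of p] assms(2) by (simp add: Complex.DeMoivre)
  finally show ?thesis by simp
qed

lemma cis_sum: "cis (\<Sum>i\<in>A. f i) = (\<Prod>i\<in>A. cis (f i))"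
  by (induction A rule: infinite_finite_induct) (simp_all flip: cis_mult)

lemma cis_2pi_eq_1D:
  assumes "cis (2 * pi * r) = 1"
  shows "r \<in> \<int>"
proof -
  obtain n :: int where "2 * pi * r = of_int (2 * n) * pi"
    using assms by (auto simp: cis_conv_exp exp_eq_1)
  then have "r = of_int n" by simp
  then show ?thesis by simp
qed

text \<open>A Haar-distributed point has coordinates \<open>cis (2\<pi> (U + N\<^sub>d) / p\<^sup>d)\<close> with \<open>U\<close> uniform
  on \<open>[0, 1]\<close> and \<open>N\<^sub>d\<close> the number formed by the first \<open>d\<close> digits of an independent uniformly
  distributed \<open>p\<close>-adic integer. The digits are
  represented by real coordinates; the floors put every sample point, not just almost every one, into
  the solenoid.\<close>

lemma exists_measure_vanishing_characters:
  assumes p: "p > 0"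
  obtains \<mu> where "prob_space \<mu>" "sets \<mu> = sets (sol_borel p)"
    "\<And>d l. (\<integral>y. y d powi l \<partial>\<mu>) = (if l = 0 then 1 else 0)"
proof -
  define M where "M i = (if i = 0 then density lborel (\<lambda>u. ennreal (indicator {0..1} u))
    else distr (measure_pmf (pmf_of_set {..<p})) borel real)" for i :: nat
  have sets_M [measurable_cong]: "sets (M i) = sets borel" for i
    by (simp add: M_def)
  have M: "prob_space (M i)" for i
  proof (cases "i = 0")
    case True
    have "prob_space (density lborel (\<lambda>u::real. ennreal (indicator {0..1} u)))"
      by (rule prob_spaceI) (simp add: emeasure_density ennreal_indicator)
    then show ?thesis using True by (simp add: M_def)
  next
    case False
    then show ?thesis by (auto simp: M_def intro!: measure_pmf.prob_space_distr)
  qed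
  interpret product_prob_space M UNIV
    by (intro product_prob_spaceI M)
  let ?\<Omega> = "PiM UNIV M"
  \<comment> \<open>Coordinate 0 of \<open>\<omega>\<close> is the uniform variable and coordinate
    \<open>Suc i\<close> is the digit with weight \<open>real p ^ i\<close>.\<close>
  define S where "S \<omega> d = \<omega> 0 + (\<Sum>i<d. real p ^ i * of_int \<lfloor>\<omega> (Suc i)\<rfloor>)" for \<omega> :: "nat \<Rightarrow> real" and d
  define Y where "Y \<omega> d = cis (2 * pi * (S \<omega> d / real p ^ d))" for \<omega> d
  have Y: "Y \<in> measurable ?\<Omega> (sol_borel p)"
  proof (rule measurable_sol_borelI)
    show "Y \<in> borel_measurable ?\<Omega>"
      unfolding Y_def S_def
      by (intro measurable_coordinatewise_then_product) measurable
    have "Y \<omega> (Suc d) ^ p = Y \<omega> d" for \<omega> d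
    proof -
      \<comment> \<open>Multiplying the angle by \<open>p\<close> turns the contribution of the top
        digit into an integer multiple of 2 pi, which \<open>cis\<close> does not see.\<close>
      have "real p * (2 * pi * (S \<omega> (Suc d) / real p ^ Suc d)) =
          2 * pi * (S \<omega> d / real p ^ d) + 2 * pi * of_int \<lfloor>\<omega> (Suc d)\<rfloor>"
        using p by (simp add: S_def field_simps)
      then show ?thesis
        by (simp add: Y_def Complex.DeMoivre flip: cis_mult)
    qed
    then show "Y \<omega> \<in> solenoid p" for \<omega>
      by (simp add: solenoid_def) (simp add: Y_def)
  qed
  have coef: "(\<integral>y. y d powi l \<partial>distr ?\<Omega> (sol_borel p) Y) = (if l = 0 then 1 else 0)" for d l
  proof (cases "l = 0")
    case True
    then show ?thesis
      using P.prob_space integral_distr[OF Y, of "\<lambda>_. 1 :: complex"] by simp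
  next
    case False
    \<comment> \<open>The factor of the character that belongs to coordinate \<open>i\<close>; the
      exponent \<open>i - 1\<close> undoes the index shift of the digits.\<close>
    define f where "f i x = (if i = 0 then cis (2 * pi * (l / p ^ d) * x)
      else cis (2 * pi * (l * p ^ (i - 1) / p ^ d) * of_int \<lfloor>x\<rfloor>))" for i :: nat and x :: real
    have Y_powi: "Y \<omega> d powi l = (\<Prod>i<Suc d. f i (\<omega> i))" for \<omega>
    proof -
      have "l * (2 * pi * (S \<omega> d / real p ^ d)) = 2 * pi * (l / p ^ d) * \<omega> 0 +
          (\<Sum>i<d. 2 * pi * (l * p ^ i / p ^ d) * of_int \<lfloor>\<omega> (Suc i)\<rfloor>)"
        by (simp add: S_def algebra_simps add_divide_distrib sum_distrib_left sum_divide_distrib)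
      then have "Y \<omega> d powi l = f 0 (\<omega> 0) * (\<Prod>i<d. f (Suc i) (\<omega> (Suc i)))"
        by (simp add: Y_def cis_power_int f_def flip: cis_mult cis_sum)
      then show ?thesis by (simp only: prod.lessThan_Suc_shift)
    qed
    have int: "integrable (M i) (f i)" for i
    proof -
      have "f i \<in> borel_measurable (M i)"
        unfolding f_def by measurable
      then show ?thesis
        by (intro M.integrable_const_bound[where B = 1]) (auto simp: f_def)
    qed
    \<comment> \<open>The coefficient is a product over independent coordinates, so one vanishing
      factor suffices. If \<open>p ^ d\<close> divides \<open>l\<close>, the uniform variable has a
      nonzero integer frequency; otherwise some digit provides the factor.\<close>
    have "\<exists>i<Suc d. (\<integral>x. f i x \<partial>M i) = 0"
    proof (cases "int p ^ d dvd l")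
      case True
      then obtain m where m: "l = int p ^ d * m" by blast
      have "(\<integral>x. f 0 x \<partial>M 0) = 0"
        using integral_cis_period[of m] m p \<open>l \<noteq> 0\<close> by (simp add: f_def M_def)
      then show ?thesis by blast
    next
      case ndvd: False
      \<comment> \<open>By minimality of \<open>k\<close>, the number
        \<open>l * p ^ (k - 1) / p ^ d\<close> is not an integer while \<open>p\<close> times it is.
        Hence the factor at coordinate \<open>k\<close> averages over the powers of a nontrivial
        \<open>p\<close>-th root of unity. Non-divisibility gives \<open>k > 0\<close>.\<close>
      define k where "k = (LEAST k. int p ^ d dvd l * int p ^ k)"
      have k: "int p ^ d dvd l * int p ^ k"
        unfolding k_def by (rule LeastI[of _ d]) simp
      have "k \<le> d" unfolding k_def by (rule Least_le) simp
      from ndvd k obtain j where j: "k = Suc j" by (cases k) auto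
      have nj: "\<not> int p ^ d dvd l * int p ^ j"
        using not_less_Least[of j "\<lambda>k. int p ^ d dvd l * int p ^ k"] j by (simp add: k_def)
      let ?a = "2 * pi * (l * p ^ j / p ^ d)"
      from k obtain m where m: "l * int p ^ Suc j = int p ^ d * m" using j by blast
      have "of_int (l * int p ^ Suc j) / real p ^ d = of_int m"
        unfolding m using p by simp
      moreover have "real p * ?a = 2 * pi * (of_int (l * int p ^ Suc j) / real p ^ d)"
        by simp
      ultimately have "real p * ?a = 2 * pi * of_int m"
        by (simp only:)
      then have 1: "cis (real p * ?a) = 1" by simp
      have 2: "cis ?a \<noteq> 1"
      proof
        assume "cis ?a = 1"
        then obtain m where "of_int l * real p ^ j / real p ^ d = of_int m"
          using cis_2pi_eq_1D[of "l * p ^ j / p ^ d"] by (auto elim: Ints_cases)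
        then have "real_of_int (l * int p ^ j) = real_of_int (int p ^ d * m)"
          using p by (simp add: field_simps)
        then show False using nj by (metis dvd_triv_left of_int_eq_iff)
      qed
      have "(\<integral>x. f k x \<partial>M k) = 0"
        using integral_cis_digits[OF p 1 2] j by (simp add: f_def M_def)
      then show ?thesis using \<open>k \<le> d\<close> by (intro exI[of _ k]) simp
    qed
    then have zero: "(\<Prod>i<Suc d. \<integral>x. f i x \<partial>M i) = 0"
      by (intro prod_zero) auto
    have "(\<integral>y. y d powi l \<partial>distr ?\<Omega> (sol_borel p) Y) = (\<integral>\<omega>. (\<Prod>i<Suc d. f i (\<omega> i)) \<partial>?\<Omega>)"
      by (simp only: integral_distr[OF Y measurable_character] Y_powi)
    also have "\<dots> = 0"
      using zero by (subst integral_PiM_prod) (use int in auto)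
    finally show ?thesis using False by simp
  qed
  show thesis
    by (rule that[of "distr ?\<Omega> (sol_borel p) Y"]) (use P.prob_space_distr[OF Y] coef in auto)
qed

section \<open>Translations and the Haar measure\<close>

lemma sol_mult_in_solenoid:
  assumes "x \<in> solenoid p" "y \<in> solenoid p"
  shows "sol_mult x y \<in> solenoid p"
  using assms unfolding solenoid_def sol_mult_def mem_Collect_eq mem_sphere_0 norm_mult
  by (metis mult_1 power_mult_distrib)

lemma sol_mult_measurable:
  assumes "x \<in> solenoid p"
  shows "sol_mult x \<in> measurable (sol_borel p) (sol_borel p)"
proof (rule measurable_sol_borelI)
  show "sol_mult x \<in> borel_measurable (sol_borel p)"
    unfolding sol_mult_def by (intro measurable_coordinatewise_then_product) measurable
qed (use assms in \<open>simp add: sol_mult_in_solenoid\<close>)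

text \<open>Translation by \<open>x\<close> multiplies each coefficient by the value of the
  character at \<open>x\<close>. Invariance therefore forces the coefficients of nontrivial
  characters to vanish, and conversely a measure with these coefficients is invariant. This yields
  uniqueness and existence.\<close>

lemma haar_measure:
  assumes p: "p > 0"
  shows "prob_space (haar_measure p)"
    and "sets (haar_measure p) = sets (sol_borel p)"
    and "(\<integral>y. y d powi l \<partial>haar_measure p) = (if l = 0 then 1 else 0)"
proof -
  define P where "P \<mu> \<longleftrightarrow> prob_space \<mu> \<and> sets \<mu> = sets (sol_borel p) \<and>
    (\<forall>x \<in> solenoid p. distr \<mu> (sol_borel p) (sol_mult x) = \<mu>)" for \<mu>
  have translate: "(\<integral>y. y d powi l \<partial>distr \<mu> (sol_borel p) (sol_mult x)) =
      x d powi l * (\<integral>y. y d powi l \<partial>\<mu>)"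
    if "sets \<mu> = sets (sol_borel p)" "x \<in> solenoid p" for \<mu> x d l
  proof -
    have "sol_mult x \<in> measurable \<mu> (sol_borel p)"
      using sol_mult_measurable[OF that(2)] measurable_cong_sets[OF that(1) refl] by blast
    then show ?thesis
      by (simp add: integral_distr sol_mult_def power_int_mult_distrib)
  qed
  have coef: "(\<integral>y. y d powi l \<partial>\<mu>) = (if l = 0 then 1 else 0)" if \<mu>: "P \<mu>" for \<mu> d l
  proof (cases "l = 0")
    case True
    then show ?thesis using \<mu> prob_space.prob_space[of \<mu>] by (simp add: P_def)
  next
    case False
    \<comment> \<open>This point of the one-parameter subgroup has coordinate
      \<open>x d = cis (pi / l)\<close>, so the character takes the value -1 at it.\<close>
    define x where "x j = cis (pi * real p ^ d / of_int l / real p ^ j)" for j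
    have x: "x \<in> solenoid p"
      unfolding x_def by (rule cis_curve_in_solenoid[OF p])
    have "x d powi l = - 1"
      using False p by (simp add: x_def cis_power_int)
    then have "(\<integral>y. y d powi l \<partial>\<mu>) = - (\<integral>y. y d powi l \<partial>\<mu>)"
      using translate[OF _ x, of \<mu> d l] \<mu> x by (simp add: P_def)
    then show ?thesis using False by (simp add: equation_minus_iff)
  qed
  obtain \<mu> where \<mu>: "prob_space \<mu>" "sets \<mu> = sets (sol_borel p)"
    "\<And>d l. (\<integral>y. y d powi l \<partial>\<mu>) = (if l = 0 then 1 else 0)"
    using exists_measure_vanishing_characters[OF p] by blast
  have "distr \<mu> (sol_borel p) (sol_mult x) = \<mu>" if x: "x \<in> solenoid p" for x
  proof (rule solenoid_measure_eqI[of _ p])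
    have "sol_mult x \<in> measurable \<mu> (sol_borel p)"
      using sol_mult_measurable[OF x] measurable_cong_sets[OF \<mu>(2) refl] by blast
    then show "prob_space (distr \<mu> (sol_borel p) (sol_mult x))"
      by (rule prob_space.prob_space_distr[OF \<mu>(1)])
  qed (use \<mu> translate[OF \<mu>(2) x] in auto)
  then have "P \<mu>" using \<mu> by (simp add: P_def)
  moreover have "\<mu>1 = \<mu>2" if "P \<mu>1" "P \<mu>2" for \<mu>1 \<mu>2
    by (rule solenoid_measure_eqI[of _ p]) (use that coef[OF that(1)] coef[OF that(2)] in \<open>simp_all add: P_def\<close>)
  ultimately have "P (THE \<mu>. P \<mu>)"
    by (intro theI[of P])
  then have haar: "P (haar_measure p)"
    by (simp add: haar_measure_def P_def)
  then show "prob_space (haar_measure p)" "sets (haar_measure p) = sets (sol_borel p)"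
    unfolding P_def by blast+
  show "(\<integral>y. y d powi l \<partial>haar_measure p) = (if l = 0 then 1 else 0)"
    by (rule coef[OF haar])
qed

subsection \<open>Arguments on the circle and powers of the cosine\<close>

lemma circle_arg_cis:
  assumes "- pi \<le> x" "x < pi"
  shows "circle_arg (cis x) = x"
  unfolding circle_arg_def
proof (rule the_equality)
  fix y assume y: "- pi \<le> y \<and> y < pi \<and> cis y = cis x"
  then have "cis (2 * pi * ((y - x) / (2 * pi))) = 1"
    by (simp flip: cis_divide)
  then obtain m :: int where m: "(y - x) / (2 * pi) = of_int m"
    using cis_2pi_eq_1D Ints_cases by metis
  moreover have "\<bar>(y - x) / (2 * pi)\<bar> < 1"
    using y assms by (simp add: abs_less_iff field_simps)
  ultimately have "m = 0" by linarith
  then show "y = x" using m by simp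
qed (use assms in auto)

text \<open>On the unit circle \<open>Arg\<close> and \<open>circle_arg\<close> differ only at -1,
  so near 1 the continuity of \<open>Arg\<close> can be used.\<close>

lemma tendsto_circle_arg:
  assumes z: "(z \<longlongrightarrow> 1) F" and norm: "\<forall>\<^sub>F n in F. norm (z n) = 1"
  shows "((\<lambda>n. circle_arg (z n)) \<longlongrightarrow> 0) F"
    and "\<forall>\<^sub>F n in F. cis (circle_arg (z n)) = z n"
proof -
  have Arg: "((\<lambda>n. Arg (z n)) \<longlongrightarrow> 0) F"
    using isCont_tendsto_compose[OF continuous_at_Arg z] by simp
  have "\<forall>\<^sub>F n in F. \<bar>Arg (z n)\<bar> < pi"
    using order_tendstoD(2)[OF tendsto_rabs[OF Arg], of pi] by simp
  with norm have eq: "\<forall>\<^sub>F n in F. Arg (z n) = circle_arg (z n) \<and> cis (circle_arg (z n)) = z n"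
  proof eventually_elim
    case (elim n)
    then have "z n \<noteq> 0" by auto
    then have "cis (Arg (z n)) = z n"
      using elim by (simp add: cis_Arg sgn_div_norm)
    moreover have "circle_arg (cis (Arg (z n))) = Arg (z n)"
      by (rule circle_arg_cis) (use elim in auto)
    ultimately show ?case by simp
  qed
  show "((\<lambda>n. circle_arg (z n)) \<longlongrightarrow> 0) F"
    by (rule Lim_transform_eventually[OF Arg]) (use eq in \<open>auto elim: eventually_mono\<close>)
  show "\<forall>\<^sub>F n in F. cis (circle_arg (z n)) = z n"
    using eq by (auto elim: eventually_mono)
qed

text \<open>The argument of \<open>x n d\<close> tends to 0, so \<open>p ^ d\<close> times it
  eventually lies strictly between -pi and pi. It is then the principal argument of
  \<open>x n 0\<close>, without wrapping around.\<close>

lemma solenoid_coordinate_eq_cis: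
  assumes p: "p > 0" and x: "\<forall>\<^sub>F n in F. x n \<in> solenoid p" and lim: "\<And>d. ((\<lambda>n. x n d) \<longlongrightarrow> 1) F"
  shows "\<forall>\<^sub>F n in F. x n d = cis (circle_arg (x n 0) / real p ^ d)"
proof -
  let ?\<phi> = "\<lambda>n. circle_arg (x n d)"
  have norm: "\<forall>\<^sub>F n in F. norm (x n d) = 1"
    using x by eventually_elim (rule solenoid_norm)
  have "((\<lambda>n. real p ^ d * ?\<phi> n) \<longlongrightarrow> 0) F"
    by (intro tendsto_mult_right_zero tendsto_circle_arg lim norm)
  then have "\<forall>\<^sub>F n in F. \<bar>real p ^ d * ?\<phi> n\<bar> < pi"
    using order_tendstoD(2)[OF tendsto_rabs, of _ 0 F pi] by simp
  with x tendsto_circle_arg(2)[OF lim norm] show ?thesis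
  proof eventually_elim
    case (elim n)
    have "x n 0 = x n d ^ (p ^ d)"
      using solenoid_power[OF elim(1), of 0 d] by simp
    also have "\<dots> = cis (?\<phi> n) ^ (p ^ d)" by (simp add: elim)
    also have "\<dots> = cis (real p ^ d * ?\<phi> n)" by (simp add: Complex.DeMoivre)
    finally have "circle_arg (x n 0) = real p ^ d * ?\<phi> n"
      using elim by (simp add: circle_arg_cis abs_less_iff)
    then show ?case using elim p by simp
  qed
qed

section \<open>Powers of the cosine and their limits\<close>

text \<open>The quotient \<open>ln (cos u) / u\<^sup>2\<close> is extended continuously by its limit
  -1/2 at 0. The identity thus also covers indices at which \<theta> vanishes.\<close>

lemma ln_cos_quadratic:
  fixes \<theta> :: "'a \<Rightarrow> real"
  assumes "(\<theta> \<longlongrightarrow> 0) F"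
  obtains h where "(h \<longlongrightarrow> - 1 / 2) F" "\<And>n. ln (cos (\<theta> n)) = h n * (\<theta> n)\<^sup>2"
proof
  define g :: "real \<Rightarrow> real" where "g u = (if u = 0 then - 1 / 2 else ln (cos u) / u\<^sup>2)" for u
  have "((\<lambda>u::real. ln (cos u) / u\<^sup>2) \<longlongrightarrow> - 1 / 2) (at 0)"
    by real_asymp
  moreover have "\<forall>\<^sub>F u in at 0. ln (cos u) / u\<^sup>2 = g u"
    by (simp add: g_def eventually_at_filter)
  ultimately have "(g \<longlongrightarrow> - 1 / 2) (at 0)"
    by (rule Lim_transform_eventually)
  then have "isCont g 0" by (simp add: isCont_def g_def)
  then show "((\<lambda>n. g (\<theta> n)) \<longlongrightarrow> - 1 / 2) F"
    using isCont_tendsto_compose[OF _ assms] by (fastforce simp: g_def)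
  show "ln (cos (\<theta> n)) = g (\<theta> n) * (\<theta> n)\<^sup>2" for n
    by (simp add: g_def)
qed

text \<open>The cosine is eventually positive, so the power can be written through its logarithm;
  its behaviour is then governed by \<open>real (K n) * (\<theta> n)\<^sup>2\<close> alone, up to a
  convergent factor.\<close>

lemma cos_power_eq_exp:
  fixes K :: "'a \<Rightarrow> nat"
  assumes "(\<theta> \<longlongrightarrow> 0) F"
  obtains h where "(h \<longlongrightarrow> - 1 / 2) F"
    "\<forall>\<^sub>F n in F. cos (\<theta> n) ^ K n = exp (h n * (real (K n) * (\<theta> n)\<^sup>2))"
proof -
  obtain h where h: "(h \<longlongrightarrow> - 1 / 2) F" "\<And>n. ln (cos (\<theta> n)) = h n * (\<theta> n)\<^sup>2"
    using ln_cos_quadratic[OF assms] by blast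
  have "((\<lambda>n. cos (\<theta> n)) \<longlongrightarrow> cos 0) F"
    by (rule isCont_tendsto_compose[OF isCont_cos assms])
  then have "\<forall>\<^sub>F n in F. cos (\<theta> n) > 0"
    by (rule order_tendstoD) simp
  then have "\<forall>\<^sub>F n in F. cos (\<theta> n) ^ K n = exp (h n * (real (K n) * (\<theta> n)\<^sup>2))"
  proof eventually_elim
    case (elim n)
    have "cos (\<theta> n) ^ K n = exp (real (K n) * ln (cos (\<theta> n)))"
      using elim by (simp only: exp_of_nat_mult exp_ln)
    also have "real (K n) * ln (cos (\<theta> n)) = h n * (real (K n) * (\<theta> n)\<^sup>2)"
      by (simp only: h mult_ac)
    finally show ?case .
  qed
  with h(1) show thesis by (rule that)
qed

lemma tendsto_cos_power:
  fixes K :: "'a \<Rightarrow> nat"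
  assumes \<theta>: "(\<theta> \<longlongrightarrow> 0) F" and b: "((\<lambda>n. real (K n) * (\<theta> n)\<^sup>2) \<longlongrightarrow> b) F"
  shows "((\<lambda>n. cos (\<theta> n) ^ K n) \<longlongrightarrow> exp (- (b / 2))) F"
proof -
  obtain h where h: "(h \<longlongrightarrow> - 1 / 2) F"
    "\<forall>\<^sub>F n in F. cos (\<theta> n) ^ K n = exp (h n * (real (K n) * (\<theta> n)\<^sup>2))"
    using cos_power_eq_exp[OF \<theta>] by blast
  have "((\<lambda>n. exp (h n * (real (K n) * (\<theta> n)\<^sup>2))) \<longlongrightarrow> exp (- 1 / 2 * b)) F"
    by (intro tendsto_intros h b)
  then show ?thesis
    using tendsto_cong[OF h(2)] by simp
qed

lemma tendsto_cos_power_zero: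
  fixes K :: "'a \<Rightarrow> nat"
  assumes \<theta>: "(\<theta> \<longlongrightarrow> 0) F" and top: "filterlim (\<lambda>n. real (K n) * (\<theta> n)\<^sup>2) at_top F"
  shows "((\<lambda>n. cos (\<theta> n) ^ K n) \<longlongrightarrow> 0) F"
proof -
  obtain h where h: "(h \<longlongrightarrow> - 1 / 2) F"
    "\<forall>\<^sub>F n in F. cos (\<theta> n) ^ K n = exp (h n * (real (K n) * (\<theta> n)\<^sup>2))"
    using cos_power_eq_exp[OF \<theta>] by blast
  have "filterlim (\<lambda>n. h n * (real (K n) * (\<theta> n)\<^sup>2)) at_bot F"
    by (rule filterlim_tendsto_neg_mult_at_bot[OF h(1) _ top]) simp
  then have "((\<lambda>n. exp (h n * (real (K n) * (\<theta> n)\<^sup>2))) \<longlongrightarrow> 0) F"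
    by (rule filterlim_compose[OF exp_at_bot])
  then show ?thesis
    using tendsto_cong[OF h(2)] by simp
qed

text \<open>The exponential form solved for \<open>real (K n) * (\<theta> n)\<^sup>2\<close>: the
  factor tending to -1/2 is eventually nonzero, and its reciprocal tends to -2. This serves the two
  converse directions.\<close>

lemma cos_power_quotient:
  fixes K :: "'a \<Rightarrow> nat"
  assumes \<theta>: "(\<theta> \<longlongrightarrow> 0) F"
  obtains h where "(h \<longlongrightarrow> - 2) F" "\<forall>\<^sub>F n in F. cos (\<theta> n) ^ K n > 0"
    "\<forall>\<^sub>F n in F. h n * ln (cos (\<theta> n) ^ K n) = real (K n) * (\<theta> n)\<^sup>2"
proof -
  obtain h where h: "(h \<longlongrightarrow> - 1 / 2) F"
    "\<forall>\<^sub>F n in F. cos (\<theta> n) ^ K n = exp (h n * (real (K n) * (\<theta> n)\<^sup>2))"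
    using cos_power_eq_exp[OF \<theta>] by blast
  have "((\<lambda>n. 1 / h n) \<longlongrightarrow> 1 / (- 1 / 2)) F"
    by (intro tendsto_intros h) simp
  moreover have "\<forall>\<^sub>F n in F. cos (\<theta> n) ^ K n > 0"
    using h(2) by eventually_elim simp
  moreover have "\<forall>\<^sub>F n in F. h n < 0"
    using order_tendstoD(2)[OF h(1), of 0] by simp
  with h(2) have "\<forall>\<^sub>F n in F. 1 / h n * ln (cos (\<theta> n) ^ K n) = real (K n) * (\<theta> n)\<^sup>2"
    by eventually_elim simp
  ultimately show thesis by (intro that[of "\<lambda>n. 1 / h n"]) simp_all
qed

lemma tendsto_cos_powerD:
  fixes K :: "'a \<Rightarrow> nat"
  assumes \<theta>: "(\<theta> \<longlongrightarrow> 0) F" and lim: "((\<lambda>n. cos (\<theta> n) ^ K n) \<longlongrightarrow> exp (- (b / 2))) F"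
  shows "((\<lambda>n. real (K n) * (\<theta> n)\<^sup>2) \<longlongrightarrow> b) F"
proof -
  obtain h where h: "(h \<longlongrightarrow> - 2) F" "\<forall>\<^sub>F n in F. cos (\<theta> n) ^ K n > 0"
    "\<forall>\<^sub>F n in F. h n * ln (cos (\<theta> n) ^ K n) = real (K n) * (\<theta> n)\<^sup>2"
    using cos_power_quotient[OF \<theta>] by blast
  have "((\<lambda>n. h n * ln (cos (\<theta> n) ^ K n)) \<longlongrightarrow> - 2 * ln (exp (- (b / 2)))) F"
    by (intro tendsto_mult h tendsto_ln lim) simp
  then show ?thesis
    using h(3) by (auto dest: Lim_transform_eventually)
qed

text \<open>The powers are eventually positive, so they approach 0 from the right and their
  logarithms tend to minus infinity; the factor tending to -2 reverses the sign.\<close>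

lemma tendsto_cos_power_zeroD:
  fixes K :: "'a \<Rightarrow> nat"
  assumes \<theta>: "(\<theta> \<longlongrightarrow> 0) F" and lim: "((\<lambda>n. cos (\<theta> n) ^ K n) \<longlongrightarrow> 0) F"
  shows "filterlim (\<lambda>n. real (K n) * (\<theta> n)\<^sup>2) at_top F"
proof -
  obtain h where h: "(h \<longlongrightarrow> - 2) F" "\<forall>\<^sub>F n in F. cos (\<theta> n) ^ K n > 0"
    "\<forall>\<^sub>F n in F. h n * ln (cos (\<theta> n) ^ K n) = real (K n) * (\<theta> n)\<^sup>2"
    using cos_power_quotient[OF \<theta>] by blast
  have "\<forall>\<^sub>F n in F. cos (\<theta> n) ^ K n \<in> {0<..} \<and> cos (\<theta> n) ^ K n \<noteq> 0"
    using h(2) by eventually_elim (metis greaterThan_iff less_irrefl)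
  with lim have "filterlim (\<lambda>n. cos (\<theta> n) ^ K n) (at_right 0) F"
    by (simp only: filterlim_at simp_thms)
  then have "filterlim (\<lambda>n. ln (cos (\<theta> n) ^ K n)) at_bot F"
    by (rule filterlim_compose[OF ln_at_0])
  then have "filterlim (\<lambda>n. - ln (cos (\<theta> n) ^ K n)) at_top F"
    by (simp add: filterlim_uminus_at_bot)
  moreover have "((\<lambda>n. - h n) \<longlongrightarrow> 2) F"
    using tendsto_minus[OF h(1)] by simp
  ultimately have "filterlim (\<lambda>n. - h n * - ln (cos (\<theta> n) ^ K n)) at_top F"
    by (intro filterlim_tendsto_pos_mult_at_top[of _ 2]) simp_all
  then show ?thesis
    by (rule filterlim_mono_eventually[OF _ order_refl order_refl])
      (use h(3) in \<open>auto elim: eventually_mono\<close>)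
qed

subsection \<open>Characters of the row sums\<close>

lemma sol_sum_in_solenoid:
  assumes "\<And>i. i \<in> I \<Longrightarrow> f i \<in> solenoid p"
  shows "sol_sum f I \<in> solenoid p"
proof -
  have "norm (\<Prod>i\<in>I. f i j) = 1" for j
    using solenoid_norm[OF assms] by (simp add: prod_norm[symmetric])
  moreover have "(\<Prod>i\<in>I. f i (Suc j)) ^ p = (\<Prod>i\<in>I. f i j)" for j
    using solenoid_step[OF assms] by (simp add: prod_power_distrib)
  ultimately show ?thesis by (simp add: sol_sum_def solenoid_def)
qed

lemma sol_inv_in_solenoid:
  assumes "x \<in> solenoid p"
  shows "sol_inv x \<in> solenoid p"
proof -
  have "inverse (x (Suc j)) ^ p = inverse (x j)" for j
    using solenoid_step[OF assms, of j] by (simp add: power_inverse)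
  then show ?thesis
    using solenoid_norm[OF assms] by (simp add: sol_inv_def solenoid_def norm_inverse)
qed

text \<open>The measure is the image of a fair coin under the map choosing \<open>a\<close> or
  \<open>b\<close>, which turns the integral into a sum of two terms. The case \<open>a = b\<close>
  is included.\<close>

lemma integral_two_point:
  fixes f :: "'a \<Rightarrow> 'b :: {banach, second_countable_topology}"
  assumes \<mu>: "prob_space \<mu>" "sets \<mu> = sets N" and ab: "a \<in> space N" "b \<in> space N"
    and f: "f \<in> borel_measurable N"
    and eq: "\<And>A. A \<in> sets N \<Longrightarrow>
      measure \<mu> A = 1 / 2 * (measure (return N a) A + measure (return N b) A)"
  shows "(\<integral>y. f y \<partial>\<mu>) = (1 / 2) *\<^sub>R (f a + f b)"
proof -
  interpret prob_space \<mu> by fact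
  let ?B = "measure_pmf (pmf_of_set (UNIV :: bool set))"
  let ?c = "\<lambda>c. if c then a else b"
  have c: "?c \<in> measurable ?B N" using ab by simp
  have "\<mu> = distr ?B N ?c"
  proof (rule measure_eqI)
    fix A assume A: "A \<in> sets \<mu>"
    have "UNIV \<inter> ?c -` A = (if a \<in> A then {True} else {}) \<union> (if b \<in> A then {False} else {})"
      by (auto split: if_splits)
    then have "measure ?B (?c -` A) = 1 / 2 * (indicator A a + indicator A b)"
      by (subst measure_pmf_of_set) (auto simp: indicator_def)
    then have "measure \<mu> A = measure (distr ?B N ?c) A"
      using A \<mu>(2) c eq[of A] by (simp add: measure_return measure_distr)
    moreover have "prob_space (distr ?B N ?c)"
      by (rule measure_pmf.prob_space_distr[OF c])
    ultimately show "emeasure \<mu> A = emeasure (distr ?B N ?c) A"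
      by (simp add: emeasure_eq_measure finite_measure.emeasure_eq_measure prob_space.axioms(1))
  qed (use \<mu>(2) in simp)
  then have "(\<integral>y. f y \<partial>\<mu>) = (\<integral>x. f (?c x) \<partial>?B)"
    using integral_distr[OF c f] by simp
  also have "\<dots> = (\<Sum>x\<in>UNIV. pmf (pmf_of_set UNIV) x *\<^sub>R f (?c x))"
    by (rule integral_measure_pmf) auto
  finally show ?thesis
    by (simp add: UNIV_bool scaleR_add_right)
qed


lemma prod_power_int:
  fixes f :: "'i \<Rightarrow> 'a :: field"
  shows "(\<Prod>i\<in>I. f i) powi l = (\<Prod>i\<in>I. f i powi l)"
  by (induction I rule: infinite_finite_induct) (simp_all add: power_int_mult_distrib)

text \<open>A character is multiplicative, so on a group sum it becomes a product of independent
  bounded variables, whose expectation factorises.\<close>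

lemma (in prob_space) integral_character_sol_sum:
  assumes indep: "indep_vars (\<lambda>_. sol_borel p) X I" and "finite I"
  shows "(\<lambda>w. sol_sum (\<lambda>i. X i w) I) \<in> measurable M (sol_borel p)"
    and "(\<integral>y. y d powi l \<partial>distr M (sol_borel p) (\<lambda>w. sol_sum (\<lambda>i. X i w) I)) =
      (\<Prod>i\<in>I. \<integral>y. y d powi l \<partial>distr M (sol_borel p) (X i))"
proof -
  have rv: "X i \<in> measurable M (sol_borel p)" if "i \<in> I" for i
    using indep that by (auto simp: indep_vars_def)
  show sum: "(\<lambda>w. sol_sum (\<lambda>i. X i w) I) \<in> measurable M (sol_borel p)"
  proof (rule measurable_sol_borelI)
    show "(\<lambda>w. sol_sum (\<lambda>i. X i w) I) \<in> borel_measurable M"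
      unfolding sol_sum_def
      by (intro measurable_coordinatewise_then_product borel_measurable_prod
        measurable_compose[OF rv solenoid_coordinate_measurable])
    show "sol_sum (\<lambda>i. X i w) I \<in> solenoid p" if "w \<in> space M" for w
      using measurable_space[OF rv that] by (intro sol_sum_in_solenoid) simp
  qed
  have ind: "indep_vars (\<lambda>_. borel) (\<lambda>i w. X i w d powi l) I"
    by (rule indep_vars_compose2[OF indep measurable_character])
  have int: "integrable M (\<lambda>w. X i w d powi l)" if "i \<in> I" for i
  proof (rule integrable_const_bound[where B = 1])
    show "AE w in M. norm (X i w d powi l) \<le> 1"
      using measurable_space[OF rv[OF that]]
      by (intro AE_I2) (simp add: norm_power_int solenoid_norm[of _ p])
    show "(\<lambda>w. X i w d powi l) \<in> borel_measurable M"
      by (rule measurable_compose[OF rv[OF that] measurable_character])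
  qed
  have "(\<integral>y. y d powi l \<partial>distr M (sol_borel p) (\<lambda>w. sol_sum (\<lambda>i. X i w) I)) =
      (\<integral>w. (\<Prod>i\<in>I. X i w d powi l) \<partial>M)"
    unfolding integral_distr[OF sum measurable_character]
    by (simp only: sol_sum_def prod_power_int)
  also have "\<dots> = (\<Prod>i\<in>I. \<integral>w. X i w d powi l \<partial>M)"
    by (rule indep_vars_lebesgue_integral[OF \<open>finite I\<close> ind int])
  also have "\<dots> = (\<Prod>i\<in>I. \<integral>y. y d powi l \<partial>distr M (sol_borel p) (X i))"
    by (intro prod.cong refl) (simp add: integral_distr[OF rv measurable_character])
  finally show "(\<integral>y. y d powi l \<partial>distr M (sol_borel p) (\<lambda>w. sol_sum (\<lambda>i. X i w) I)) =
      (\<Prod>i\<in>I. \<integral>y. y d powi l \<partial>distr M (sol_borel p) (X i))" .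
qed

lemma continuous_on_sol_inv: "continuous_on (solenoid p) sol_inv"
  unfolding sol_inv_def
  by (intro continuous_on_coordinatewise_then_product continuous_on_inverse continuous_on_coordinate)
    (auto dest: solenoid_nonzero)

section \<open>Limit laws for row sums of symmetric two-point elements\<close>

theorem theorem8p3:
  fixes p :: nat
    and x :: "nat \<Rightarrow> nat \<Rightarrow> complex"
    and K :: "nat \<Rightarrow> nat"
    and M :: "'w measure"
    and X :: "nat \<Rightarrow> nat \<Rightarrow> 'w \<Rightarrow> (nat \<Rightarrow> complex)"
  assumes "prime p"
    and "\<And>n. n \<ge> 1 \<Longrightarrow> x n \<in> solenoid p"
    and "limitin (top_of_set (solenoid p)) x sol_one sequentially"
    and "prob_space M"
    and "\<And>n. n \<ge> 1 \<Longrightarrow> prob_space.indep_vars M (\<lambda>k. sol_borel p) (X n) {1..K n}"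
    and "filterlim K at_top sequentially"
    and "\<And>n k A. n \<ge> 1 \<Longrightarrow> k \<in> {1..K n} \<Longrightarrow> A \<in> sets (sol_borel p) \<Longrightarrow>
          measure (distr M (sol_borel p) (X n k)) A =
            1 / 2 * (measure (return (sol_borel p) (x n)) A
              + measure (return (sol_borel p) (sol_inv (x n))) A)"
  shows "infinitesimal_array p M K X
    \<and> (\<forall>b::real. b \<ge> 0 \<longrightarrow>
        (weak_conv_on (solenoid p)
            (\<lambda>n. distr M (sol_borel p) (\<lambda>w. sol_sum (\<lambda>k. X n k w) {1..K n})) (gauss_measure p b)
          \<longleftrightarrow> (\<lambda>n. real (K n) * (circle_arg (x n 0))\<^sup>2) \<longlonglongrightarrow> b))
    \<and> (weak_conv_on (solenoid p)
          (\<lambda>n. distr M (sol_borel p) (\<lambda>w. sol_sum (\<lambda>k. X n k w) {1..K n})) (haar_measure p)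
        \<longleftrightarrow> filterlim (\<lambda>n. real (K n) * (circle_arg (x n 0))\<^sup>2) at_top sequentially)"
proof -
  note x = assms(2) and lim = assms(3) and indep = assms(5) and K = assms(6) and dist = assms(7)
  interpret prob_space M by fact
  have p: "p > 0" by (rule prime_gt_0_nat) fact
  \<comment> \<open>The hypotheses on the rows start at index 1, so facts about rows are stated for
    eventually all \<open>n\<close>.\<close>
  have large: "\<forall>\<^sub>F n in sequentially. n \<ge> 1" by (rule eventually_ge_at_top)
  have x_ev: "\<forall>\<^sub>F n in sequentially. x n \<in> solenoid p"
    using large by eventually_elim (rule x)
  have one: "sol_one \<in> solenoid p" by (simp add: sol_one_def solenoid_def)
  have rv: "X n k \<in> measurable M (sol_borel p)" if "n \<ge> 1" "k \<in> {1..K n}" for n k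
    using indep[OF that(1)] that(2) unfolding indep_vars_def by blast
  have nbhd: "\<forall>\<^sub>F n in sequentially. x n \<in> V" if "openin (top_of_set (solenoid p)) V" "sol_one \<in> V" for V
    using lim that by (simp add: limitin_def)

  have infin: "infinitesimal_array p M K X"
    unfolding infinitesimal_array_def
  proof (intro ballI impI, elim exE conjE)
    fix U V assume U: "U \<in> sets (sol_borel p)"
      and V: "openin (top_of_set (solenoid p)) V" "sol_one \<in> V" "V \<subseteq> U"
    obtain T where T: "open T" "V = solenoid p \<inter> T" using V(1) by (auto simp: openin_open)
    \<comment> \<open>Continuity of inversion gives a neighbourhood of the identity whose inverses
      lie in \<open>T\<close>, so both values of \<open>X n k\<close> eventually lie in
      \<open>U\<close>.\<close>
    have "openin (top_of_set (solenoid p)) (solenoid p \<inter> sol_inv -` T)"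
      by (rule continuous_openin_preimage_gen[OF continuous_on_sol_inv T(1)])
    moreover have "sol_one \<in> solenoid p \<inter> sol_inv -` T"
      using V(2) T(2) by (simp add: sol_inv_def sol_one_def)
    ultimately have "\<forall>\<^sub>F n in sequentially. x n \<in> solenoid p \<inter> sol_inv -` T"
      by (rule nbhd)
    \<comment> \<open>This makes the index set nonempty, as \<open>Max\<close> requires. The maximum
      is then eventually equal to 0.\<close>
    moreover have "\<forall>\<^sub>F n in sequentially. K n \<ge> 1"
      using K by (simp add: filterlim_at_top)
    ultimately have "\<forall>\<^sub>F n in sequentially.
        Max ((\<lambda>k. measure M {w \<in> space M. X n k w \<in> solenoid p - U}) ` {1..K n}) = 0"
      using nbhd[OF V(1,2)] large
    proof eventually_elim
      case (elim n)
      have "x n \<in> U" "sol_inv (x n) \<in> U"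
        using elim T(2) V(3) sol_inv_in_solenoid[OF x] by auto
      moreover have "measure M {w \<in> space M. X n k w \<in> solenoid p - U} =
          measure (distr M (sol_borel p) (X n k)) (solenoid p - U)" if "k \<in> {1..K n}" for k
      proof -
        have "solenoid p - U \<in> sets (sol_borel p)"
          using U sets.compl_sets[of U "sol_borel p"] by simp
        then show ?thesis
          using rv[of n k] elim that by (auto simp: measure_distr intro!: arg_cong[where f = "measure M"])
      qed
      moreover have "solenoid p - U \<in> sets (sol_borel p)"
        using U sets.compl_sets[of U "sol_borel p"] by simp
      ultimately have "measure M {w \<in> space M. X n k w \<in> solenoid p - U} = 0"
        if "k \<in> {1..K n}" for k
        using dist[of n k "solenoid p - U"] elim that by (simp add: measure_return)
      then have "(\<lambda>k. measure M {w \<in> space M. X n k w \<in> solenoid p - U}) ` {1..K n} = {0}"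
        using elim by (auto simp: image_iff intro!: bexI[of _ 1])
      then show ?case by simp
    qed
    then show "(\<lambda>n. Max ((\<lambda>k. measure M {w \<in> space M. X n k w \<in> solenoid p - U}) ` {1..K n}))
        \<longlonglongrightarrow> 0"
      by (rule tendsto_eventually)
  qed

  define \<mu> where "\<mu> n = distr M (sol_borel p) (\<lambda>w. sol_sum (\<lambda>k. X n k w) {1..K n})" for n
  define \<theta> where "\<theta> n = circle_arg (x n 0)" for n
  have x_lim: "(\<lambda>n. x n d) \<longlonglongrightarrow> 1" for d
  proof -
    have "x \<longlonglongrightarrow> sol_one"
      using lim by (simp add: limitin_subtopology)
    then have "(\<lambda>n. x n d) \<longlonglongrightarrow> sol_one d"
      by (rule continuous_on_tendsto_compose[OF continuous_on_coordinate[of UNIV d]]) auto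
    then show ?thesis by (simp add: sol_one_def)
  qed
  have \<theta>: "\<theta> \<longlonglongrightarrow> 0"
    unfolding \<theta>_def
    by (rule tendsto_circle_arg(1)[OF x_lim]) (use x_ev in \<open>eventually_elim, simp add: solenoid_norm[of _ p]\<close>)
  have \<mu>: "\<forall>\<^sub>F n in sequentially. prob_space (\<mu> n) \<and> sets (\<mu> n) = sets (sol_borel p)"
    using large
  proof eventually_elim
    case (elim n)
    then show ?case
      using integral_character_sol_sum(1)[OF indep] by (simp add: \<mu>_def prob_space_distr)
  qed
  \<comment> \<open>Each of the \<open>K n\<close> identically distributed factors is the mean of
    \<open>cis ?a\<close> and \<open>cis (- ?a)\<close>, that is, \<open>cos ?a\<close>.\<close>
  have coef: "\<forall>\<^sub>F n in sequentially. (\<integral>y. y d powi l \<partial>\<mu> n) =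
      of_real (cos (of_int l / real p ^ d * \<theta> n) ^ K n)" for d l
    using large solenoid_coordinate_eq_cis[OF p x_ev x_lim, of d]
  proof eventually_elim
    case (elim n)
    let ?a = "of_int l / real p ^ d * \<theta> n"
    have "(\<integral>y. y d powi l \<partial>distr M (sol_borel p) (X n k)) = of_real (cos ?a)" if k: "k \<in> {1..K n}" for k
    proof -
      have "(\<integral>y. y d powi l \<partial>distr M (sol_borel p) (X n k)) =
          (1 / 2) *\<^sub>R (x n d powi l + sol_inv (x n) d powi l)"
        by (rule integral_two_point[OF prob_space_distr[OF rv] _ _ _ measurable_character dist])
          (use elim(1) k x sol_inv_in_solenoid[OF x] in auto)
      also have "x n d powi l = cis ?a"
        by (simp add: elim \<theta>_def cis_power_int)
      also have "sol_inv (x n) d powi l = cis (- ?a)"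
        by (simp add: sol_inv_def elim \<theta>_def cis_power_int)
      also have "(1 / 2) *\<^sub>R (cis ?a + cis (- ?a)) = of_real (cos ?a)"
        by (simp add: complex_eq_iff)
      finally show ?thesis .
    qed
    then show ?case
      using integral_character_sol_sum(2)[OF indep[OF elim(1)], of d l] by (simp add: \<mu>_def)
  qed
  have coef_lim: "(\<lambda>n. \<integral>y. y d powi l \<partial>\<mu> n) \<longlonglongrightarrow> of_real c"
    if "(\<lambda>n. cos (of_int l / real p ^ d * \<theta> n) ^ K n) \<longlonglongrightarrow> c" for d l c
    using tendsto_of_real[OF that] tendsto_cong[OF coef] by blast
  \<comment> \<open>The character \<open>y 0\<close>, with \<open>d = 0\<close> and
    \<open>l = 1\<close>, has coefficient \<open>cos (\<theta> n) ^ K n\<close>; it alone gives both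
    converse directions.\<close>
  have cos_lim: "(\<lambda>n. cos (\<theta> n) ^ K n) \<longlonglongrightarrow> c"
    if "(\<lambda>n. Re (\<integral>y. y 0 powi 1 \<partial>\<mu> n)) \<longlonglongrightarrow> c" for c
    by (rule Lim_transform_eventually[OF that])
      (use coef[of 0 1] in \<open>eventually_elim, simp\<close>)
  \<comment> \<open>A general character replaces \<theta> by its multiple with
    \<open>a = l / p ^ d\<close>, which scales the governing quantity by
    \<open>a\<^sup>2\<close>.\<close>
  have scaled: "(\<lambda>n. a * \<theta> n) \<longlonglongrightarrow> 0"
    "(\<lambda>n. real (K n) * (a * \<theta> n)\<^sup>2) = (\<lambda>n. a\<^sup>2 * (real (K n) * (\<theta> n)\<^sup>2))" for a
    using tendsto_mult_right_zero[OF \<theta>] by (simp_all add: power_mult_distrib mult_ac)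

  have gauss: "weak_conv_on (solenoid p) \<mu> (gauss_measure p b) \<longleftrightarrow>
      (\<lambda>n. real (K n) * (\<theta> n)\<^sup>2) \<longlonglongrightarrow> b" if b: "b \<ge> 0" for b
  proof
    assume "weak_conv_on (solenoid p) \<mu> (gauss_measure p b)"
    from weak_conv_on_solenoidD[OF this \<mu> gauss_measure(1,2)[OF p b], of 0 1]
    have "(\<lambda>n. cos (\<theta> n) ^ K n) \<longlonglongrightarrow> exp (- (b / 2))"
      by (intro cos_lim) (simp only: gauss_measure(3)[OF p b], simp)
    then show "(\<lambda>n. real (K n) * (\<theta> n)\<^sup>2) \<longlonglongrightarrow> b"
      by (rule tendsto_cos_powerD[OF \<theta>])
  next
    assume Kb: "(\<lambda>n. real (K n) * (\<theta> n)\<^sup>2) \<longlonglongrightarrow> b"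
    show "weak_conv_on (solenoid p) \<mu> (gauss_measure p b)"
    proof (rule weak_conv_on_solenoidI[OF \<mu> gauss_measure(1,2)[OF p b]])
      fix d l
      have "(\<lambda>n. cos (of_int l / real p ^ d * \<theta> n) ^ K n) \<longlonglongrightarrow>
          exp (- ((of_int l / real p ^ d)\<^sup>2 * b / 2))"
        by (rule tendsto_cos_power[OF scaled(1)])
          (unfold scaled(2), intro tendsto_mult tendsto_const Kb)
      also have "(of_int l / real p ^ d)\<^sup>2 * b / 2 = b * (of_int l)\<^sup>2 / (2 * real p ^ (2 * d))"
        by (simp add: power_divide mult_ac flip: power_mult)
      finally show "(\<lambda>n. \<integral>y. y d powi l \<partial>\<mu> n) \<longlonglongrightarrow> (\<integral>y. y d powi l \<partial>gauss_measure p b)"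
        unfolding gauss_measure(3)[OF p b] by (rule coef_lim)
    qed
  qed

  have haar: "weak_conv_on (solenoid p) \<mu> (haar_measure p) \<longleftrightarrow>
      filterlim (\<lambda>n. real (K n) * (\<theta> n)\<^sup>2) at_top sequentially"
  proof
    assume "weak_conv_on (solenoid p) \<mu> (haar_measure p)"
    from weak_conv_on_solenoidD[OF this \<mu> haar_measure(1,2)[OF p], of 0 1]
    have "(\<lambda>n. cos (\<theta> n) ^ K n) \<longlonglongrightarrow> 0"
      by (intro cos_lim) (simp only: haar_measure(3)[OF p], simp)
    then show "filterlim (\<lambda>n. real (K n) * (\<theta> n)\<^sup>2) at_top sequentially"
      by (rule tendsto_cos_power_zeroD[OF \<theta>])
  next
    assume Kb: "filterlim (\<lambda>n. real (K n) * (\<theta> n)\<^sup>2) at_top sequentially"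
    show "weak_conv_on (solenoid p) \<mu> (haar_measure p)"
    proof (rule weak_conv_on_solenoidI[OF \<mu> haar_measure(1,2)[OF p]])
      fix d l
      have "(\<lambda>n. cos (of_int l / real p ^ d * \<theta> n) ^ K n) \<longlonglongrightarrow> (if l = 0 then 1 else 0)"
      proof (cases "l = 0")
        case False
        \<comment> \<open>For a nontrivial character the scaling factor is positive and preserves
          divergence. For \<open>l = 0\<close> all the powers are 1.\<close>
        have "filterlim (\<lambda>n. (of_int l / real p ^ d)\<^sup>2 * (real (K n) * (\<theta> n)\<^sup>2)) at_top sequentially"
          by (rule filterlim_tendsto_pos_mult_at_top[OF tendsto_const _ Kb]) (use False p in simp)
        then show ?thesis
          using tendsto_cos_power_zero[OF scaled(1), of K "of_int l / real p ^ d"] False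
          by (simp only: scaled(2) if_False simp_thms)
      qed simp
      from coef_lim[OF this]
      show "(\<lambda>n. \<integral>y. y d powi l \<partial>\<mu> n) \<longlonglongrightarrow> (\<integral>y. y d powi l \<partial>haar_measure p)"
        unfolding haar_measure(3)[OF p] by (cases "l = 0") simp_all
    qed
  qed
  show ?thesis
    using infin gauss haar by (simp only: \<mu>_def[abs_def] \<theta>_def) blast
qed

end
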